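(* Let $\alpha,\beta,b,c,z,p\in\mathbb{C}$ with $\mathrm{Re}(\alpha)>-1$, with $\mathrm{Re}(p)>0$ or $p=0$, and with $\mathrm{Re}(c)>\mathrm{Re}(b)>0$. Then $${}^{\Psi}\Phi_{p}^{(\alpha,\beta)}(b;c;z)=\exp(z)\;{}^{\Psi}\Phi_{p}^{(\alpha,\beta)}(c-b;c;-z).$$
   Context: For $\alpha,\beta\in\mathbb{C}$ with $\mathrm{Re}(\alpha)>-1$, the Wright function is ${}_{0}\Psi_{1}(\alpha,\beta;z)=\sum_{n=0}^{\infty}\frac{1}{\Gamma(\alpha n+\beta)}\frac{z^n}{n!}$ (with $1/\Gamma$ equal to $0$ at the poles of $\Gamma$). The $\Psi$-beta function is, for $\mathrm{Re}(x)>0$, $\mathrm{Re}(y)>0$ and $\mathrm{Re}(p)>0$ (or $p=0$, by the same formula), $${}^{\Psi}B_{p}^{(\alpha,\beta)}(x,y)=\int_{0}^{1}t^{x-1}(1-t)^{y-1}\,{}_{0}\Psi_{1}\left(\alpha,\beta;-\frac{p}{t(1-t)}\right)dt.$$ The $\Psi$-confluent hypergeometric function is $${}^{\Psi}\Phi_{p}^{(\alpha,\beta)}(b;c;z)=\sum_{n=0}^{\infty}\frac{{}^{\Psi}B_{p}^{(\alpha,\beta)}(b+n,c-b)}{B(b,c-b)}\frac{z^{n}}{n!},$$ where $B$ is the classical beta function.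
   Formalization: For p ≠ 0 it is additionally assumed that the integral defining the Ψ-beta function at (b, c−b) converges (possibly only conditionally); it can diverge under the stated conditions, e.g. for α = −1/2, β = 1/2, p = 1+2i. *)

theory Defs
  imports "HOL-Analysis.Analysis"
begin

text \<open>The reciprocal Gamma function \<^const>\<open>rGamma\<close> is entire and vanishes at the poles
  of \<^const>\<open>Gamma\<close>, as the convention for the coefficients requires.\<close>

definition wright :: "complex \<Rightarrow> complex \<Rightarrow> complex \<Rightarrow> complex" where
  "wright \<alpha> \<beta> z = (\<Sum>n. rGamma (\<alpha> * of_nat n + \<beta>) * (z ^ n / fact n))"

definition psi_beta_integrand ::
  "complex \<Rightarrow> complex \<Rightarrow> complex \<Rightarrow> complex \<Rightarrow> complex \<Rightarrow> real \<Rightarrow> complex" where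
  "psi_beta_integrand \<alpha> \<beta> p x y t =
     of_real t powr (x - 1) * of_real (1 - t) powr (y - 1) *
     wright \<alpha> \<beta> (- (p / of_real (t * (1 - t))))"

text \<open>The integral is the Henstock--Kurzweil integral, so that both absolutely convergent and
  conditionally convergent improper integrals are covered. The value of the integrand at the
  two end points is irrelevant. If the integral diverges, the value is the default 0.\<close>

definition psi_beta ::
  "complex \<Rightarrow> complex \<Rightarrow> complex \<Rightarrow> complex \<Rightarrow> complex \<Rightarrow> complex" where
  "psi_beta \<alpha> \<beta> p x y = integral {0..1} (psi_beta_integrand \<alpha> \<beta> p x y)"

definition psi_confluent ::
  "complex \<Rightarrow> complex \<Rightarrow> complex \<Rightarrow> complex \<Rightarrow> complex \<Rightarrow> complex \<Rightarrow> complex" where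
  "psi_confluent \<alpha> \<beta> p b c z =
     (\<Sum>n. psi_beta \<alpha> \<beta> p (b + of_nat n) (c - b) / Beta b (c - b) * (z ^ n / fact n))"

end

theory Submission
  imports Defs
begin

text \<open>
  Up to the constant factor $1/B(b,c-b)$, the coefficients of the series on the left are the
  moments $\int_0^1 t^n f(t)\,dt$ of one function, the integrand $f$ of the \<open>\<Psi>\<close>-beta function
  at $(b, c-b)$. Swapping $b$ and $c-b$ reflects $f$ in the midpoint of the interval, because
  $t(1-t)$ is symmetric; so the coefficients on the right are the reflected moments
  $\int_0^1 (1-t)^n f(t)\,dt$. Heuristically, both sides are then
  $\int_0^1 e^{zt} f(t)\,dt = e^z \int_0^1 e^{-z(1-t)} f(t)\,dt$.

  The integral of $f$ may converge only conditionally, so that dominated convergence cannot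
  justify the exchange of sum and integral. The exchange is avoided: expanding
  $t^m = (1-(1-t))^m$ by the binomial theorem writes each moment as a finite combination of
  reflected moments, and these combinations are exactly the coefficients of the Cauchy product
  of $e^z$ with the series of reflected moments (\<open>kummer_transformation_of_moments\<close>). All that
  analysis has to supply is that the moments exist and are bounded, which makes that series
  absolutely convergent. Both follow from the second mean value theorem, which holds for
  conditionally convergent integrals since each $t^n$ is monotone (\<open>moments_real\<close>).

  For \<open>p = 0\<close> the Wright factor is constant, and the integrability of $f$ is that of the
  classical beta integrand.
\<close>

section \<open>Moments of an integrable function on the unit interval\<close>

text \<open>By the second mean value theorem, the \<open>n\<close>-th moment equals the integral of \<open>f\<close> over some
  \<open>{c..1}\<close>, to which \<open>n = 0\<close> alone adds the integral over \<open>{0..c}\<close>. The integrals over initial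
  segments are bounded because they depend continuously on the end point.\<close>

lemma moments_real:
  fixes f :: "real \<Rightarrow> real"
  assumes f: "f integrable_on {0..1}"
  shows "(\<lambda>t. t ^ n * f t) integrable_on {0..1}"
    and "\<exists>M. \<forall>n. \<bar>integral {0..1} (\<lambda>t. t ^ n * f t)\<bar> \<le> M"
proof -
  have "continuous_on {0..1} (\<lambda>x. integral {0..x} f)"
    using f by (rule indefinite_integral_continuous_1)
  then have "bounded ((\<lambda>x. integral {0..x} f) ` {0..1})"
    by (intro compact_imp_bounded compact_continuous_image) auto
  then obtain K where "\<forall>x\<in>{0..1}. \<bar>integral {0..x} f\<bar> \<le> K"
    by (auto simp: bounded_iff)
  then have K: "\<bar>integral {0..x} f\<bar> \<le> K" if "x \<in> {0..1}" for x
    using that by blast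
  have *: "\<exists>I. ((\<lambda>t. t ^ n * f t) has_integral I) {0..1} \<and> \<bar>I\<bar> \<le> 3 * K" for n
  proof -
    obtain c where c: "c \<in> {0..1}"
      and I: "((\<lambda>t. t ^ n * f t) has_integral
        (0 ^ n * integral {0..c} f + 1 ^ n * integral {c..1} f)) {0..1}"
      by (rule second_mean_value_theorem_full[OF f, of "\<lambda>t. t ^ n"])
         (auto intro: power_mono)
    \<comment> \<open>The integral over \<open>{c..1}\<close> is a difference of two over initial segments, hence at most
      \<open>2 * K\<close>; the first summand adds another \<open>K\<close>.\<close>
    have "integral {0..c} f + integral {c..1} f = integral {0..1} f"
      using c f by (intro Henstock_Kurzweil_Integration.integral_combine) auto
    moreover have "\<bar>0 ^ n * integral {0..c} f\<bar> \<le> K"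
      using K[OF c] by (cases n) auto
    ultimately have "\<bar>0 ^ n * integral {0..c} f + 1 ^ n * integral {c..1} f\<bar> \<le> 3 * K"
      using K[OF c] K[of 1] by auto
    with I show ?thesis by blast
  qed
  show "(\<lambda>t. t ^ n * f t) integrable_on {0..1}"
    using *[of n] by (auto simp: integrable_on_def)
  show "\<exists>M. \<forall>n. \<bar>integral {0..1} (\<lambda>t. t ^ n * f t)\<bar> \<le> M"
    using * by (metis integral_unique)
qed

definition moment :: "(real \<Rightarrow> complex) \<Rightarrow> nat \<Rightarrow> complex" where
  "moment f n = integral {0..1} (\<lambda>t. of_real t ^ n * f t)"

lemma integrable_on_iff_Re_Im:
  fixes f :: "real \<Rightarrow> complex"
  shows "f integrable_on S \<longleftrightarrow>
    (\<lambda>t. Re (f t)) integrable_on S \<and> (\<lambda>t. Im (f t)) integrable_on S"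
  by (subst integrable_componentwise_iff) (auto simp: Basis_complex_def)

lemma has_integral_moment:
  assumes "f integrable_on {0..1}"
  shows "((\<lambda>t. of_real t ^ n * f t) has_integral moment f n) {0..1}"
proof -
  have "(\<lambda>t. of_real t ^ n * f t) integrable_on {0..1}"
    using assms unfolding integrable_on_iff_Re_Im
    by (simp add: moments_real(1) flip: of_real_power)
  then show ?thesis
    unfolding moment_def by (rule integrable_integral)
qed

lemma moments_bounded:
  assumes f: "f integrable_on {0..1}"
  shows "\<exists>M. \<forall>n. norm (moment f n) \<le> M"
proof -
  have R: "(\<lambda>t. Re (f t)) integrable_on {0..1}" and I: "(\<lambda>t. Im (f t)) integrable_on {0..1}"
    using f by (simp_all add: integrable_on_iff_Re_Im)
  obtain M where M: "\<And>n. \<bar>integral {0..1} (\<lambda>t. t ^ n * Re (f t))\<bar> \<le> M"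
    using moments_real(2)[OF R] by blast
  obtain N where N: "\<And>n. \<bar>integral {0..1} (\<lambda>t. t ^ n * Im (f t))\<bar> \<le> N"
    using moments_real(2)[OF I] by blast
  have "norm (moment f n) \<le> M + N" for n
  proof -
    have "Re (moment f n) = integral {0..1} (\<lambda>t. t ^ n * Re (f t))"
      using has_integral_linear[OF has_integral_moment[OF f, of n] bounded_linear_Re]
      by (simp add: o_def integral_unique flip: of_real_power)
    moreover have "Im (moment f n) = integral {0..1} (\<lambda>t. t ^ n * Im (f t))"
      using has_integral_linear[OF has_integral_moment[OF f, of n] bounded_linear_Im]
      by (simp add: o_def integral_unique flip: of_real_power)
    ultimately show ?thesis
      using cmod_le[of "moment f n"] M[of n] N[of n] by linarith
  qed
  then show ?thesis by blast
qed

section \<open>Reflection in the midpoint\<close>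

lemma has_integral_reflect_unit_interval:
  fixes f :: "real \<Rightarrow> 'a::banach"
  assumes "(f has_integral I) {0..1}"
  shows "((\<lambda>t. f (1 - t)) has_integral I) {0..1}"
proof -
  have "(\<lambda>x. 1 - x) ` {0..1} = {0..1::real}"
    by (auto simp: image_iff intro!: bexI[of _ "1 - _"])
  then show ?thesis
    using has_integral_affinity[of f I 0 1 "-1" 1] assms by simp
qed

lemma integrable_reflect_unit_interval:
  fixes f :: "real \<Rightarrow> 'a::banach"
  assumes "f integrable_on {0..1}"
  shows "(\<lambda>t. f (1 - t)) integrable_on {0..1}"
  using assms has_integral_reflect_unit_interval unfolding integrable_on_def by blast

text \<open>After reflection, this is the binomial expansion of \<open>(1 - t) ^ m\<close> under the integral.\<close>

lemma moment_binomial_reflect: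
  assumes f: "f integrable_on {0..1}"
  shows "moment f m =
    (\<Sum>k\<le>m. of_nat (m choose k) * (-1) ^ k * moment (\<lambda>t. f (1 - t)) k)"
proof -
  define g where "g = (\<lambda>t. f (1 - t))"
  have g: "g integrable_on {0..1}"
    unfolding g_def by (rule integrable_reflect_unit_interval[OF f])
  have "((\<lambda>t. of_real (1 - t) ^ m * g t) has_integral moment f m) {0..1}"
    unfolding g_def by (rule has_integral_reflect_unit_interval[OF has_integral_moment[OF f]])
  moreover have "((\<lambda>t. \<Sum>k\<le>m. (of_nat (m choose k) * (-1) ^ k) * (of_real t ^ k * g t))
      has_integral (\<Sum>k\<le>m. (of_nat (m choose k) * (-1) ^ k) * moment g k)) {0..1}"
    by (intro has_integral_sum has_integral_mult_right has_integral_moment g) auto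
  moreover have "(\<Sum>k\<le>m. (of_nat (m choose k) * (-1) ^ k) * (of_real t ^ k * g t)) =
      of_real (1 - t) ^ m * g t" for t
  proof -
    have "of_real (1 - t) ^ m = (- of_real t + 1 :: complex) ^ m" by simp
    also have "\<dots> = (\<Sum>k\<le>m. of_nat (m choose k) * (-1) ^ k * of_real t ^ k)"
      unfolding binomial_ring by (intro sum.cong) (auto simp: power_minus[of "of_real t"])
    finally show ?thesis by (simp add: sum_distrib_right mult.assoc)
  qed
  ultimately show ?thesis
    unfolding g_def[symmetric] by (auto dest: has_integral_unique)
qed

text \<open>Kummer's transformation for the exponential generating function of the moments: the
  coefficients of both sides agree by \<open>moment_binomial_reflect\<close>, once the right-hand side is
  multiplied out as a Cauchy product.\<close>

theorem kummer_transformation_of_moments: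
  assumes f: "f integrable_on {0..1}"
  shows "(\<Sum>n. moment f n * (z ^ n / fact n)) =
    exp z * (\<Sum>n. moment (\<lambda>t. f (1 - t)) n * ((- z) ^ n / fact n))"
proof -
  define g where "g = (\<lambda>t. f (1 - t))"
  define u where "u n = moment g n * ((- z) ^ n / fact n)" for n
  define v where "v n = z ^ n / fact n" for n
  have "g integrable_on {0..1}"
    unfolding g_def by (rule integrable_reflect_unit_interval[OF f])
  then obtain M where M: "\<And>n. norm (moment g n) \<le> M"
    using moments_bounded by blast
  have v_eq: "v n = z ^ n /\<^sub>R fact n" for n
    by (simp add: v_def scaleR_conv_of_real field_simps)
  have v: "summable (\<lambda>n. norm (v n))"
    using summable_norm_exp[of z] by (simp add: v_eq)
  have u: "summable (\<lambda>n. norm (u n))"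
  proof (rule summable_comparison_test')
    show "summable (\<lambda>n. M * norm (v n))"
      using v by (rule summable_mult)
    show "norm (norm (u n)) \<le> M * norm (v n)" for n
      using M[of n] mult_right_mono[OF M, of "norm (v n)" n]
      by (simp add: u_def v_def norm_mult norm_divide norm_power)
  qed
  have "moment f m * (z ^ m / fact m) = (\<Sum>k\<le>m. u k * v (m - k))" for m
  proof -
    have "of_nat (m choose k) * (-1) ^ k * moment g k * (z ^ m / fact m) = u k * v (m - k)"
      if "k \<le> m" for k
    proof -
      have "z ^ m = z ^ k * z ^ (m - k)"
        using that by (simp flip: power_add)
      moreover have "(of_nat (m choose k) :: complex) = fact m / (fact k * fact (m - k))"
        using that by (rule binomial_fact)
      ultimately show ?thesis
        by (simp add: u_def v_def power_minus[of z] field_simps)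
    qed
    then show ?thesis
      unfolding moment_binomial_reflect[OF f] g_def[symmetric] sum_distrib_right
      by (intro sum.cong) auto
  qed
  then have "(\<Sum>n. moment f n * (z ^ n / fact n)) = (\<Sum>n. u n) * (\<Sum>n. v n)"
    by (simp add: Cauchy_product[OF u v])
  also have "(\<Sum>n. v n) = exp z"
    by (simp add: v_eq exp_def)
  finally show ?thesis
    by (simp add: u_def g_def mult.commute)
qed

section \<open>The \<open>\<Psi>\<close>-beta integrand\<close>

text \<open>The identity holds at the end point \<open>t = 0\<close> as well, where \<open>0 powr w = 0\<close> makes both sides
  vanish.\<close>

lemma psi_beta_integrand_shift:
  "psi_beta_integrand \<alpha> \<beta> p (x + of_nat n) y t =
    of_real t ^ n * psi_beta_integrand \<alpha> \<beta> p x y t"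
proof (cases "t = 0")
  case False
  have "of_real t powr (x + of_nat n - 1) = of_real t powr ((x - 1) + of_nat n)"
    by (simp add: algebra_simps)
  also have "\<dots> = of_real t ^ n * of_real t powr (x - 1)"
    using False by (simp add: powr_add)
  finally show ?thesis
    by (simp add: psi_beta_integrand_def)
qed (simp add: psi_beta_integrand_def)

lemma psi_beta_shift_eq_moment:
  "psi_beta \<alpha> \<beta> p (x + of_nat n) y = moment (psi_beta_integrand \<alpha> \<beta> p x y) n"
  by (simp add: psi_beta_def moment_def psi_beta_integrand_shift[abs_def])

lemma psi_beta_integrand_reflect:
  "psi_beta_integrand \<alpha> \<beta> p x y (1 - t) = psi_beta_integrand \<alpha> \<beta> p y x t"
  by (simp add: psi_beta_integrand_def mult_ac)

lemma psi_confluent_eq_moments: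
  "psi_confluent \<alpha> \<beta> p b c z =
    (\<Sum>n. moment (\<lambda>t. psi_beta_integrand \<alpha> \<beta> p b (c - b) t / Beta b (c - b)) n * (z ^ n / fact n))"
  by (simp add: psi_confluent_def psi_beta_shift_eq_moment moment_def)

text \<open>The modulus of the integrand is that of the real beta integrand with the real parts of the
  parameters.\<close>

lemma Beta_integrand_integrable_complex:
  assumes "Re x > 0" and "Re y > 0"
  shows "(\<lambda>t. of_real t powr (x - 1) * of_real (1 - t) powr (y - 1) :: complex)
    integrable_on {0..1}"
proof -
  have "(\<lambda>t. of_real t powr (x - 1) * of_real (1 - t) powr (y - 1) :: complex)
      integrable_on {0<..<1}"
  proof (rule measurable_bounded_by_integrable_imp_integrable)
    show "(\<lambda>t. of_real t powr (x - 1) * of_real (1 - t) powr (y - 1) :: complex)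
        \<in> borel_measurable (lebesgue_on {0<..<1})"
      by (intro continuous_imp_measurable_on_sets_lebesgue continuous_intros) auto
    show "(\<lambda>t. t powr (Re x - 1) * (1 - t) powr (Re y - 1)) integrable_on {0<..<1}"
      using has_integral_Beta_real[OF assms]
      by (auto simp: integrable_on_def has_integral_Icc_iff_Ioo)
    show "norm (of_real t powr (x - 1) * of_real (1 - t) powr (y - 1) :: complex)
        \<le> t powr (Re x - 1) * (1 - t) powr (Re y - 1)" if "t \<in> {0<..<1}" for t
      using that by (simp add: norm_mult norm_powr_real_powr del: of_real_diff)
  qed auto
  then show ?thesis
    by (simp add: integrable_on_Icc_iff_Ioo)
qed

lemma wright_0: "wright \<alpha> \<beta> 0 = rGamma \<beta>"
  unfolding wright_def by (subst suminf_finite[of "{0}"]) auto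

lemma psi_beta_integrand_integrable_0:
  assumes "Re x > 0" and "Re y > 0"
  shows "psi_beta_integrand \<alpha> \<beta> 0 x y integrable_on {0..1}"
  using integrable_on_mult_left[OF Beta_integrand_integrable_complex[OF assms], of "rGamma \<beta>"]
  by (simp add: psi_beta_integrand_def[abs_def] wright_0)

section \<open>The transformation formula\<close>

theorem theorem3p10:
  fixes \<alpha> \<beta> b c z p :: complex
  assumes "Re \<alpha> > -1"
    and "Re p > 0 \<or> p = 0"
    and "Re c > Re b" and "Re b > 0"
    and "p \<noteq> 0 \<Longrightarrow> psi_beta_integrand \<alpha> \<beta> p b (c - b) integrable_on {0..1}"
  shows "psi_confluent \<alpha> \<beta> p b c z = exp z * psi_confluent \<alpha> \<beta> p (c - b) c (- z)"
proof -
  have "psi_beta_integrand \<alpha> \<beta> p b (c - b) integrable_on {0..1}"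
    using assms psi_beta_integrand_integrable_0[of b "c - b"] by (cases "p = 0") auto
  then have "(\<lambda>t. psi_beta_integrand \<alpha> \<beta> p b (c - b) t / Beta b (c - b)) integrable_on {0..1}"
    by (rule integrable_on_divide)
  from kummer_transformation_of_moments[OF this]
  show ?thesis
    by (simp add: psi_confluent_eq_moments psi_beta_integrand_reflect Beta_commute)
qed

end
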